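(* Let $E$ be any equivalence class of the relation $\rightarrow$ on $\beta\mathbb{N}\setminus\mathbb{N}$ given by: $p\rightarrow q$ if and only if there is a permutation $\tau$ of $\mathbb{N}$ with $q=\tau^*(p)$. Then for any two distinct points $p,q\in E$, the ring $C_p$ is isomorphic to the ring $C_q$.
   Context: $\mathbb{N}$ carries the discrete topology and $\beta\mathbb{N}$ is its Stone-Čech compactification. For a permutation $\tau:\mathbb{N}\to\mathbb{N}$, $\tau^*:\beta\mathbb{N}\to\beta\mathbb{N}$ denotes its unique continuous extension, which is a homeomorphism of $\beta\mathbb{N}$ onto itself. $C(\mathbb{N})$ is the ring of all (continuous) real-valued functions on $\mathbb{N}$. For $f\in C(\mathbb{N})$, $f^*:\beta\mathbb{N}\to\mathbb{R}\cup\{\infty\}$ (one-point compactification of $\mathbb{R}$) is the unique continuous extension of $f$. For $p\in\beta\mathbb{N}$, $C_p=\{f\in C(\mathbb{N}): f^*(p)\in\mathbb{R}\}$, a subring of $C(\mathbb{N})$ containing all bounded functions. Isomorphic means isomorphic as rings. *)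

theory Defs
  imports "HOL-Analysis.Analysis" "HOL-Algebra.QuotRing"
begin

text \<open>
  \<open>Y\<close>, together with \<open>e\<close>, is a Stone--Cech compactification of \<open>X\<close>: a compact Hausdorff space in
  which \<open>X\<close> is densely embedded via \<open>e\<close> and \<open>C\<^sup>*\<close>-embedded, i.e. every bounded continuous real
  function on \<open>X\<close> extends to \<open>Y\<close>. This determines \<open>(Y, e)\<close> up to a homeomorphism fixing \<open>X\<close>.
\<close>

definition stone_cech_compactification ::
  "'a topology \<Rightarrow> 'b topology \<Rightarrow> ('a \<Rightarrow> 'b) \<Rightarrow> bool" where
  "stone_cech_compactification X Y e \<longleftrightarrow>
     compact_space Y \<and> Hausdorff_space Y \<and>
     embedding_map X Y e \<and> Y closure_of (e ` topspace X) = topspace Y \<and>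
     (\<forall>f. continuous_map X euclideanreal f \<and> bounded (f ` topspace X) \<longrightarrow>
        (\<exists>g. continuous_map Y euclideanreal g \<and> (\<forall>x\<in>topspace X. g (e x) = f x)))"

abbreviation discrete_nat :: "nat topology" where
  "discrete_nat \<equiv> discrete_topology UNIV"

text \<open>
  The unique continuous map \<open>g : Y \<rightarrow> Z\<close> with \<open>g \<circ> e = f\<close> on \<open>X\<close>. Since a continuous map is
  unconstrained outside the topspace of its domain, uniqueness needs \<^const>\<open>extensional\<close>.
\<close>

definition cont_extension ::
  "'a topology \<Rightarrow> 'b topology \<Rightarrow> ('a \<Rightarrow> 'b) \<Rightarrow> 'c topology \<Rightarrow> ('a \<Rightarrow> 'c) \<Rightarrow> 'b \<Rightarrow> 'c" where
  "cont_extension X Y e Z f =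
     (THE g. g \<in> extensional (topspace Y) \<and> continuous_map Y Z g \<and>
             (\<forall>x\<in>topspace X. g (e x) = f x))"

definition perm_ext :: "'b topology \<Rightarrow> (nat \<Rightarrow> 'b) \<Rightarrow> (nat \<Rightarrow> nat) \<Rightarrow> 'b \<Rightarrow> 'b" where
  "perm_ext bN e \<tau> = cont_extension discrete_nat bN e bN (e \<circ> \<tau>)"

text \<open>
  \<open>f\<^sup>* : \<beta>\<nat> \<rightarrow> \<real> \<union> {\<infinity>}\<close>. In \<^const>\<open>Alexandroff_compactification\<close> the real \<open>r\<close> is \<open>Some r\<close> and the
  point \<open>\<infinity>\<close> is \<open>None\<close>.
\<close>

definition real_ext :: "'b topology \<Rightarrow> (nat \<Rightarrow> 'b) \<Rightarrow> (nat \<Rightarrow> real) \<Rightarrow> 'b \<Rightarrow> real option" where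
  "real_ext bN e f =
     cont_extension discrete_nat bN e (Alexandroff_compactification euclideanreal) (Some \<circ> f)"

definition pointwise_ring :: "('a \<Rightarrow> real) set \<Rightarrow> ('a \<Rightarrow> real) ring" where
  "pointwise_ring F =
     \<lparr>carrier = F, mult = (\<lambda>f g x. f x * g x), one = (\<lambda>x. 1),
      zero = (\<lambda>x. 0), add = (\<lambda>f g x. f x + g x)\<rparr>"

definition C_at :: "'b topology \<Rightarrow> (nat \<Rightarrow> 'b) \<Rightarrow> 'b \<Rightarrow> (nat \<Rightarrow> real) ring" where
  "C_at bN e p = pointwise_ring
     {f. continuous_map discrete_nat euclideanreal f \<and> real_ext bN e f p \<in> range Some}"

definition remainder :: "'b topology \<Rightarrow> (nat \<Rightarrow> 'b) \<Rightarrow> 'b set" where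
  "remainder bN e = topspace bN - range e"

definition perm_rel :: "'b topology \<Rightarrow> (nat \<Rightarrow> 'b) \<Rightarrow> ('b \<times> 'b) set" where
  "perm_rel bN e = {(p, q). p \<in> remainder bN e \<and> q \<in> remainder bN e \<and>
                            (\<exists>\<tau>. bij \<tau> \<and> q = perm_ext bN e \<tau> p)}"

end

theory Submission
  imports Defs
begin

text \<open>
  By uniqueness of extensions, \<open>f\<^sup>* \<circ> \<tau>\<^sup>* = (f \<circ> \<tau>)\<^sup>*\<close>, so \<open>f\<close> lies in \<open>C\<close> at \<open>\<tau>\<^sup>*(x)\<close> iff \<open>f \<circ> \<tau>\<close> lies in
  \<open>C\<close> at \<open>x\<close>. If \<open>p = \<tau>\<^sup>*(x)\<close> and \<open>q = \<sigma>\<^sup>*(x)\<close> with \<open>x\<close> a representative of the class, then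
  \<open>f \<mapsto> f \<circ> \<tau> \<circ> \<sigma>\<^sup>-\<^sup>1\<close> is a ring isomorphism. The topological input is that the extension property
  for bounded real functions implies the one for maps to any compact Hausdorff space.
\<close>

text \<open>A compact Hausdorff space is completely regular, hence embeds in a cube. The factors are
  widened from \<open>{0..1}\<close> to the whole line so that each coordinate is a bounded real
  function, to which the extension property applies; a continuous injection from a compact space to
  a Hausdorff one is still an embedding.\<close>

lemma compact_Hausdorff_real_cube_embedding:
  fixes Z :: "'c topology"
  assumes "compact_space Z" "Hausdorff_space Z"
  obtains K :: "('c \<Rightarrow> real) set" and h
  where "embedding_map Z (powertop_real K) h"
    and "\<And>k z. k \<in> K \<Longrightarrow> z \<in> topspace Z \<Longrightarrow> h z k \<in> {0..1}"
proof -
  have "completely_regular_space Z"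
    by (simp add: assms compact_Hausdorff_or_regular_imp_normal_space
        normal_imp_completely_regular_space)
  then obtain K :: "('c \<Rightarrow> real) set" and h
    where emb: "embedding_map Z (product_topology (\<lambda>f. top_of_set {0..1::real}) K) h"
    using completely_regular_space_cube_embedding assms(2) by blast
  then have cont: "continuous_map Z (product_topology (\<lambda>f. top_of_set {0..1::real}) K) h"
    and inj: "inj_on h (topspace Z)"
    unfolding embedding_map_def homeomorphic_eq_everything_map
    by (auto simp: continuous_map_in_subtopology)
  show thesis
  proof
    have "continuous_map Z (powertop_real K) h"
      using cont by (auto simp: continuous_map_componentwise continuous_map_in_subtopology)
    moreover have "Hausdorff_space (powertop_real K)"
      by (simp add: Hausdorff_space_product_topology)
    ultimately show "embedding_map Z (powertop_real K) h"
      using inj assms(1) continuous_imp_embedding_map by blast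
    show "h z k \<in> {0..1}" if "k \<in> K" "z \<in> topspace Z" for k z
      using continuous_map_image_subset_topspace[OF cont] that by (auto simp: image_subset_iff PiE_iff)
  qed
qed

text \<open>With \<open>Z\<close> embedded in a real power by \<open>h\<close>, each coordinate of
  \<open>h \<circ> f\<close> is bounded and extends to \<open>Y\<close>. The extensions assemble to
  a map into the power, whose values stay in the image of \<open>Z\<close>, and the inverse of
  \<open>h\<close> brings them back to \<open>Z\<close>.\<close>

lemma stone_cech_extension_exists:
  assumes sc: "stone_cech_compactification X Y e"
    and Z: "compact_space Z" "Hausdorff_space Z"
    and f: "continuous_map X Z f"
  obtains g where "continuous_map Y Z g" "\<And>x. x \<in> topspace X \<Longrightarrow> g (e x) = f x"
proof -
  obtain K :: "('c \<Rightarrow> real) set" and h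
    where emb: "embedding_map Z (powertop_real K) h"
      and h01: "\<And>k z. k \<in> K \<Longrightarrow> z \<in> topspace Z \<Longrightarrow> h z k \<in> {0..1}"
    using compact_Hausdorff_real_cube_embedding[OF Z] by blast
  let ?S = "h ` topspace Z"
  from emb obtain h' where h': "homeomorphic_maps Z (subtopology (powertop_real K) ?S) h h'"
    unfolding embedding_map_def homeomorphic_map_maps by blast
  then have conth: "continuous_map Z (powertop_real K) h"
    and conth': "continuous_map (subtopology (powertop_real K) ?S) Z h'"
    and h'h: "\<And>z. z \<in> topspace Z \<Longrightarrow> h' (h z) = z"
    by (auto simp: homeomorphic_maps_def continuous_map_in_subtopology)
  have fZ: "f x \<in> topspace Z" if "x \<in> topspace X" for x
    using f that by (auto simp: continuous_map_def)
  have dense: "Y closure_of (e ` topspace X) = topspace Y"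
    using sc by (simp add: stone_cech_compactification_def)
  have "\<exists>g. continuous_map Y euclideanreal g \<and> (\<forall>x\<in>topspace X. g (e x) = h (f x) k)"
    if "k \<in> K" for k
  proof -
    have "continuous_map X euclideanreal (\<lambda>x. h (f x) k)"
      using continuous_map_compose[OF f conth] that by (auto simp: continuous_map_componentwise o_def)
    moreover have "bounded ((\<lambda>x. h (f x) k) ` topspace X)"
      by (rule bounded_subset[OF bounded_closed_interval[of 0 1]]) (use h01[OF that] fZ in blast)
    ultimately show ?thesis
      using sc unfolding stone_cech_compactification_def by blast
  qed
  then obtain G where G: "\<And>k. k \<in> K \<Longrightarrow> continuous_map Y euclideanreal (G k)"
    and Ge: "\<And>k x. k \<in> K \<Longrightarrow> x \<in> topspace X \<Longrightarrow> G k (e x) = h (f x) k"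
    by metis
  \<comment> \<open>Points of the product are extensional on \<open>K\<close>, hence the restricted
    abstraction.\<close>
  define H where "H y = (\<lambda>k\<in>K. G k y)" for y
  have contH: "continuous_map Y (powertop_real K) H"
    using G by (auto simp: H_def continuous_map_componentwise)
  have He: "H (e x) = h (f x)" if "x \<in> topspace X" for x
  proof -
    have "h (f x) \<in> extensional K"
      using continuous_map_image_subset_topspace[OF conth] fZ[OF that]
      by (auto simp: image_subset_iff PiE_iff)
    then show ?thesis
      by (auto simp: H_def Ge that intro!: extensionalityI[of _ K])
  qed
  have "closedin (powertop_real K) ?S"
    using image_compactin[OF _ conth] Z(1) compactin_imp_closedin[of "powertop_real K"]
    by (simp add: compact_space_def Hausdorff_space_product_topology)
  moreover have "H ` e ` topspace X \<subseteq> ?S"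
    using He fZ by auto
  ultimately have "H ` topspace Y \<subseteq> ?S"
    using continuous_map_image_closure_subset[OF contH, of "e ` topspace X"] closure_of_minimal
    unfolding dense by blast
  then have "continuous_map Y Z (h' \<circ> H)"
    using contH conth' by (intro continuous_map_compose) (auto simp: continuous_map_in_subtopology)
  then show thesis
    using that[of "h' \<circ> H"] He h'h fZ by simp
qed

lemma stone_cech_extension_unique:
  assumes sc: "stone_cech_compactification X Y e" and Z: "Hausdorff_space Z"
    and g: "continuous_map Y Z g" and g': "continuous_map Y Z g'"
    and eq: "\<And>x. x \<in> topspace X \<Longrightarrow> g (e x) = g' (e x)"
    and y: "y \<in> topspace Y"
  shows "g y = g' y"
proof (rule forall_in_closure_of_eq[OF _ Z g g'])
  show "y \<in> Y closure_of (e ` topspace X)"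
    using sc y by (simp add: stone_cech_compactification_def)
qed (use eq in auto)

lemma cont_extension_works:
  assumes sc: "stone_cech_compactification X Y e"
    and Z: "compact_space Z" "Hausdorff_space Z"
    and f: "continuous_map X Z f"
  shows "continuous_map Y Z (cont_extension X Y e Z f)"
    and "\<And>x. x \<in> topspace X \<Longrightarrow> cont_extension X Y e Z f (e x) = f x"
proof -
  let ?P = "\<lambda>g. g \<in> extensional (topspace Y) \<and> continuous_map Y Z g \<and>
                (\<forall>x\<in>topspace X. g (e x) = f x)"
  obtain g where g: "continuous_map Y Z g" "\<And>x. x \<in> topspace X \<Longrightarrow> g (e x) = f x"
    using stone_cech_extension_exists[OF sc Z f] by blast
  have eY: "e x \<in> topspace Y" if "x \<in> topspace X" for x
    using sc that unfolding stone_cech_compactification_def embedding_map_def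
    by (auto simp: homeomorphic_eq_everything_map continuous_map_in_subtopology continuous_map_def)
  \<comment> \<open>Restricting an arbitrary extension meets the \<open>extensional\<close> clause;
    density of the image of \<open>e\<close> then gives uniqueness, so \<open>THE\<close> is well
    defined.\<close>
  have "?P (restrict g (topspace Y))"
    using g eY by (auto intro: continuous_map_eq[OF g(1)])
  moreover have "a = b" if "?P a" "?P b" for a b
    using that stone_cech_extension_unique[OF sc Z(2), of a b]
    by (auto intro!: extensionalityI[of _ "topspace Y"])
  ultimately have "\<exists>!g. ?P g"
    by blast
  from theI'[OF this] have "?P (cont_extension X Y e Z f)"
    unfolding cont_extension_def .
  then show "continuous_map Y Z (cont_extension X Y e Z f)"
    and "\<And>x. x \<in> topspace X \<Longrightarrow> cont_extension X Y e Z f (e x) = f x"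
    by auto
qed

lemma real_ext_perm_ext:
  assumes sc: "stone_cech_compactification discrete_nat bN e" and x: "x \<in> topspace bN"
  shows "real_ext bN e f (perm_ext bN e \<tau> x) = real_ext bN e (f \<circ> \<tau>) x"
proof -
  let ?A = "Alexandroff_compactification euclideanreal"
  \<comment> \<open>The one-point compactification is Hausdorff because the real line is locally
    compact Hausdorff.\<close>
  have A: "compact_space ?A" "Hausdorff_space ?A"
    by (auto simp: Hausdorff_space_Alexandroff_compactification locally_compact_space_euclidean)
  have B: "compact_space bN" "Hausdorff_space bN" and emb: "embedding_map discrete_nat bN e"
    using sc by (simp_all add: stone_cech_compactification_def)
  have "continuous_map discrete_nat bN e"
    using emb unfolding embedding_map_def homeomorphic_eq_everything_map
    by (simp only: continuous_map_in_subtopology)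
  then have "continuous_map discrete_nat bN (e \<circ> \<tau>)"
    by auto
  note \<tau> = cont_extension_works[OF sc B this, folded perm_ext_def]
  have "continuous_map discrete_nat ?A (Some \<circ> g)" for g :: "nat \<Rightarrow> real"
    by auto
  note r = cont_extension_works[OF sc A this, folded real_ext_def]
  \<comment> \<open>Both sides are continuous in \<open>x\<close> and take the value
    \<open>Some (f (\<tau> n))\<close> at \<open>e n\<close>.\<close>
  have "(real_ext bN e f \<circ> perm_ext bN e \<tau>) x = real_ext bN e (f \<circ> \<tau>) x"
    by (rule stone_cech_extension_unique[OF sc A(2) continuous_map_compose[OF \<tau>(1) r(1)] r(1) _ x])
       (simp add: \<tau>(2) r(2))
  then show ?thesis
    by simp
qed

lemma C_at_perm_ext:
  assumes "stone_cech_compactification discrete_nat bN e" and "x \<in> topspace bN"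
  shows "f \<in> carrier (C_at bN e (perm_ext bN e \<tau> x)) \<longleftrightarrow> f \<circ> \<tau> \<in> carrier (C_at bN e x)"
  by (simp add: C_at_def pointwise_ring_def real_ext_perm_ext[OF assms])

text \<open>Precomposition respects pointwise operations and constants; \<open>iff\<close> makes it
  carry \<open>F\<close> onto \<open>G\<close>, with precomposition by the inverse of
  \<open>\<pi>\<close> as its inverse.\<close>

lemma is_ring_iso_pointwise_ring_comp:
  assumes \<pi>: "bij \<pi>" and iff: "\<And>f. f \<in> F \<longleftrightarrow> f \<circ> \<pi> \<in> G"
  shows "is_ring_iso (pointwise_ring F) (pointwise_ring G)"
proof -
  have "bij_betw (\<lambda>f. f \<circ> \<pi>) F G"
  proof (rule bij_betw_byWitness[where f' = "\<lambda>g. g \<circ> inv_into UNIV \<pi>"])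
    have inv: "g \<circ> inv_into UNIV \<pi> \<circ> \<pi> = g" for g :: "_ \<Rightarrow> real"
      using \<pi> by (simp add: fun_eq_iff bij_is_inj)
    then show "\<forall>g\<in>G. g \<circ> inv_into UNIV \<pi> \<circ> \<pi> = g"
      by simp
    show "\<forall>f\<in>F. f \<circ> \<pi> \<circ> inv_into UNIV \<pi> = f"
      using \<pi> by (simp add: fun_eq_iff bij_is_surj surj_f_inv_f)
    show "(\<lambda>f. f \<circ> \<pi>) ` F \<subseteq> G"
      using iff by blast
    show "(\<lambda>g. g \<circ> inv_into UNIV \<pi>) ` G \<subseteq> F"
    proof (rule image_subsetI)
      show "g \<circ> inv_into UNIV \<pi> \<in> F" if "g \<in> G" for g
        using that unfolding iff inv .
    qed
  qed
  then have "(\<lambda>f. f \<circ> \<pi>) \<in> ring_iso (pointwise_ring F) (pointwise_ring G)"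
    using bij_betw_imp_funcset by (simp add: ring_iso_def ring_hom_def pointwise_ring_def o_def)
  then show ?thesis
    unfolding is_ring_iso_def by blast
qed

theorem theorem2p11:
  fixes bN :: "'b topology" and e :: "nat \<Rightarrow> 'b" and E :: "'b set" and p q :: 'b
  assumes "stone_cech_compactification discrete_nat bN e"
    and "E \<in> remainder bN e // perm_rel bN e"
    and "p \<in> E" and "q \<in> E" and "p \<noteq> q"
  shows "is_ring_iso (C_at bN e p) (C_at bN e q)"
proof -
  \<comment> \<open>\<open>x\<close> is a representative whose image under \<open>perm_rel\<close>
    is \<open>E\<close>, so \<open>p\<close> and \<open>q\<close> are compared through
    \<open>x\<close>.\<close>
  obtain x \<tau> \<sigma> where x: "x \<in> topspace bN" and \<tau>: "bij \<tau>" "p = perm_ext bN e \<tau> x"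
    and \<sigma>: "bij \<sigma>" "q = perm_ext bN e \<sigma> x"
    using assms(2-4) by (auto simp: quotient_def perm_rel_def remainder_def)
  \<comment> \<open>Since \<open>inv_into UNIV \<sigma> \<circ> \<sigma>\<close> is the identity,
    both sides reduce to \<open>f \<circ> \<tau>\<close> lying in the ring at
    \<open>x\<close>.\<close>
  have "f \<in> carrier (C_at bN e p) \<longleftrightarrow> f \<circ> (\<tau> \<circ> inv_into UNIV \<sigma>) \<in> carrier (C_at bN e q)" for f
    using C_at_perm_ext[OF assms(1) x] \<tau> \<sigma> by (simp add: o_assoc[symmetric] bij_is_inj)
  moreover have "bij (\<tau> \<circ> inv_into UNIV \<sigma>)"
    using \<tau> \<sigma> by (simp add: bij_comp bij_imp_bij_inv)
  ultimately show ?thesis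
    using is_ring_iso_pointwise_ring_comp[of "\<tau> \<circ> inv_into UNIV \<sigma>" "carrier (C_at bN e p)" "carrier (C_at bN e q)"]
    by (simp add: C_at_def pointwise_ring_def)
qed

end
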